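(* For every integer $n \ge 4$, the derangement graph $\Gamma_n$ is edge pancyclic; that is, every edge of $\Gamma_n$ lies on a cycle of length $\ell$ for every integer $\ell$ with $3 \le \ell \le n!$.
   Context: Let $S_n$ be the symmetric group on $[n]=\{1,\ldots,n\}$ and let $D_n\subseteq S_n$ be the set of derangements, i.e. permutations with no fixed points. For a finite group $G$ and an inverse-closed subset $S\subseteq G$ with $1\notin S$, the Cayley graph $\Gamma(G,S)$ is the simple graph with vertex set $G$ in which $u,v\in G$ are adjacent if and only if $v=su$ for some $s\in S$. The derangement graph is $\Gamma_n=\Gamma(S_n,D_n)$; equivalently, two vertices $g,h\in S_n$ are adjacent if and only if $g(i)\ne h(i)$ for all $i\in[n]$. A graph of order $N\ge 3$ is edge pancyclic if every edge lies on a cycle of each length from $3$ to $N$. *)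

theory Defs
  imports "HOL-Algebra.Sym_Groups" "Graph_Theory.Pair_Digraph" "Graph_Theory.Arc_Walk"
begin

text \<open>
  A simple graph is a finite loop-free symmetric digraph without parallel arcs (locale
  \<^locale>\<open>graph\<close>, or \<^locale>\<open>pair_graph\<close> when arcs are pairs of vertices): an
  undirected edge \<open>{u, v}\<close> is represented by the two arcs \<open>(u, v)\<close> and \<open>(v, u)\<close>.
\<close>

definition cayley_graph :: "('a, 'm) monoid_scheme \<Rightarrow> 'a set \<Rightarrow> 'a pair_pre_digraph" where
  "cayley_graph G S =
     \<lparr> pverts = carrier G,
       parcs = {(u, v). u \<in> carrier G \<and> v \<in> carrier G \<and> (\<exists>s\<in>S. v = s \<otimes>\<^bsub>G\<^esub> u)} \<rparr>"

definition derangements :: "nat \<Rightarrow> (nat \<Rightarrow> nat) set" where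
  "derangements n = {p \<in> carrier (sym_group n). \<forall>i\<in>{1..n}. p i \<noteq> i}"

definition derangement_graph :: "nat \<Rightarrow> (nat \<Rightarrow> nat) pair_pre_digraph" where
  "derangement_graph n = cayley_graph (sym_group n) (derangements n)"

text \<open>
  \<^const>\<open>pre_digraph.cycle\<close> is a directed closed walk, given by its arcs, whose vertices are
  distinct. In a simple graph of this encoding such a walk of length at least 3 is an undirected
  cycle with one of its two orientations. (Going back and forth along an edge is a cycle of
  length 2 for the library, but lengths start at 3 here.) Reversing the walk shows that requiring
  the arc \<open>e\<close> itself, rather than \<open>e\<close> or its reverse, makes no difference.
\<close>

definition edge_pancyclic :: "('a, 'b) pre_digraph \<Rightarrow> bool" where
  "edge_pancyclic G \<longleftrightarrow>
     graph G \<and> 3 \<le> card (verts G) \<and>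
     (\<forall>e\<in>arcs G. \<forall>l\<in>{3..card (verts G)}.
        \<exists>p. pre_digraph.cycle G p \<and> length p = l \<and> e \<in> set p)"

lemma pair_graph_cayley_graph:
  assumes "group G" "finite (carrier G)" "S \<subseteq> carrier G" "\<one>\<^bsub>G\<^esub> \<notin> S"
    and inv: "\<And>s. s \<in> S \<Longrightarrow> inv\<^bsub>G\<^esub> s \<in> S"
  shows "pair_graph (cayley_graph G S)"
proof -
  interpret group G by fact
  let ?C = "cayley_graph G S"
  have fin: "finite (parcs ?C)"
    by (rule finite_subset[of _ "carrier G \<times> carrier G"])
      (use assms(2) in \<open>auto simp: cayley_graph_def\<close>)
  have loopfree: "u \<noteq> v" if uv: "(u, v) \<in> parcs ?C" for u v
  proof
    assume "u = v"
    then obtain s where "s \<in> S" "u \<in> carrier G" "u = s \<otimes>\<^bsub>G\<^esub> u"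
      using uv by (auto simp: cayley_graph_def)
    with assms(3) have "s = \<one>\<^bsub>G\<^esub>" by (metis r_cancel_one' subsetD)
    with \<open>s \<in> S\<close> assms(4) show False by simp
  qed
  have sym: "sym (parcs ?C)"
  proof (rule symI)
    fix u v assume "(u, v) \<in> parcs ?C"
    then obtain s where s: "s \<in> S" "u \<in> carrier G" "v \<in> carrier G" "v = s \<otimes>\<^bsub>G\<^esub> u"
      unfolding cayley_graph_def by auto
    have sC: "s \<in> carrier G" using s(1) assms(3) by blast
    have "u = inv\<^bsub>G\<^esub> s \<otimes>\<^bsub>G\<^esub> v"
      using inv_solve_left[OF s(2) sC s(3)] s(4) by blast
    then have "\<exists>t\<in>S. u = t \<otimes>\<^bsub>G\<^esub> v" using inv[OF s(1)] by blast
    then show "(v, u) \<in> parcs ?C" using s(2,3) by (simp add: cayley_graph_def)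
  qed
  have wf: "fst e \<in> pverts ?C \<and> snd e \<in> pverts ?C" if "e \<in> parcs ?C" for e
    using that by (auto simp: cayley_graph_def)
  have "finite (pverts ?C)" using assms(2) by (simp add: cayley_graph_def)
  moreover have "symmetric (with_proj ?C)" using sym by (simp add: symmetric_def)
  moreover have "fst e \<noteq> snd e" if "e \<in> parcs ?C" for e
    using loopfree[of "fst e" "snd e"] that by simp
  ultimately show ?thesis
    using fin wf by unfold_locales blast+
qed

lemma card_derangement_graph: "card (pverts (derangement_graph n)) = fact n"
  using card_permutations[of "{1..n}" n]
  by (simp add: derangement_graph_def cayley_graph_def sym_group_def)

lemma derangement_graph_adj_iff:
  assumes "g \<in> carrier (sym_group n)" "h \<in> carrier (sym_group n)"
  shows "(g, h) \<in> parcs (derangement_graph n) \<longleftrightarrow> (\<forall>i\<in>{1..n}. g i \<noteq> h i)"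
proof -
  have g: "g permutes {1..n}" and h: "h permutes {1..n}"
    using assms by (auto simp: sym_group_carrier)
  show ?thesis
  proof
    assume "(g, h) \<in> parcs (derangement_graph n)"
    then obtain s where s: "s \<in> derangements n" "h = s \<circ> g"
      by (auto simp: derangement_graph_def cayley_graph_def sym_group_mult)
    show "\<forall>i\<in>{1..n}. g i \<noteq> h i"
    proof
      fix i assume "i \<in> {1..n}"
      then have "g i \<in> {1..n}" using permutes_in_image[OF g] by blast
      then have "s (g i) \<noteq> g i" using s(1) unfolding derangements_def by blast
      then show "g i \<noteq> h i" using s(2) by simp
    qed
  next
    assume neq: "\<forall>i\<in>{1..n}. g i \<noteq> h i"
    let ?s = "h \<circ> inv' g"
    have ginv: "inv' g permutes {1..n}" by (rule permutes_inv[OF g])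
    have "?s permutes {1..n}" by (rule permutes_compose[OF ginv h])
    moreover have "?s j \<noteq> j" if "j \<in> {1..n}" for j
    proof -
      have "inv' g j \<in> {1..n}" using that permutes_in_image[OF ginv] by blast
      with neq have "g (inv' g j) \<noteq> h (inv' g j)" by blast
      then show ?thesis by (simp add: permutes_inverses[OF g])
    qed
    ultimately have "?s \<in> derangements n"
      by (simp add: derangements_def sym_group_carrier)
    moreover have "h = ?s \<circ> g" by (simp add: comp_assoc permutes_inv_o[OF g])
    ultimately show "(g, h) \<in> parcs (derangement_graph n)"
      using assms by (auto simp: derangement_graph_def cayley_graph_def sym_group_mult)
  qed
qed

lemma pair_graph_derangement_graph:
  assumes "n \<ge> 1"
  shows "pair_graph (derangement_graph n)"
  unfolding derangement_graph_def
proof (rule pair_graph_cayley_graph)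
  show "group (sym_group n)" by (rule sym_group_is_group)
  show "finite (carrier (sym_group n))"
    by (simp add: sym_group_def finite_permutations)
  show "derangements n \<subseteq> carrier (sym_group n)" by (auto simp: derangements_def)
  show "\<one>\<^bsub>sym_group n\<^esub> \<notin> derangements n"
    using assms by (auto simp: derangements_def sym_group_one)
next
  fix s assume s: "s \<in> derangements n"
  then have p: "s permutes {1..n}" by (simp add: derangements_def sym_group_carrier)
  have "inv\<^bsub>sym_group n\<^esub> s = inv' s"
    by (rule group.inv_equality[OF sym_group_is_group])
      (use p permutes_inv[OF p] permutes_inv_o[OF p] in
        \<open>auto simp: sym_group_carrier sym_group_mult sym_group_one\<close>)
  moreover have "inv' s \<in> derangements n"
  proof -
    have "inv' s i \<noteq> i" if "i \<in> {1..n}" for i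
    proof
      assume "inv' s i = i"
      then have "s i = i" using permutes_inverses(1)[OF p, of i] by simp
      with s that show False unfolding derangements_def by blast
    qed
    then show ?thesis using permutes_inv[OF p]
      by (simp add: derangements_def sym_group_carrier)
  qed
  ultimately show "inv\<^bsub>sym_group n\<^esub> s \<in> derangements n" by simp
qed

end

theory Submission
  imports Defs "HOL-Number_Theory.Cong"
begin

text \<open>
  Rotating the positions splits the permutations into \<open>(n - 1)!\<close> cliques of size \<open>n\<close>, one for
  each permutation \<open>g\<close> fixing \<open>n\<close>. The cliques of \<open>g\<close> and \<open>g \<circ> (k k+1)\<close> with \<open>k \<le> n - 2\<close> are
  joined by a perfect matching, and these joins connect all cliques. Thus, starting from a path from
  \<open>u\<close> to \<open>v\<close> in the cliques of \<open>u\<close> and \<open>v\<close>, one can absorb the other cliques one by one, replacing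
  an edge \<open>ab\<close> inside an old clique by \<open>a a' \<dots> b' b\<close>, where \<open>a' \<dots> b'\<close> visits any number
  from \<open>2\<close> to \<open>n\<close> of the vertices of the new clique. Each clique has at most \<open>n - 2\<close> neighbours,
  so its \<open>n - 1\<close> path edges suffice. If \<open>u\<close> and \<open>v\<close> lie in different cliques, the initial path
  uses the edge obtained from \<open>uv\<close> by a rotation.
\<close>

subsection \<open>Absorbing cliques into a path\<close>

text \<open>These are the edges of the path at which a detour can still be spliced in. Counting them
  on vertex lists lets the count split when a path is cut.\<close>

fun inner_steps :: "'a set \<Rightarrow> 'a list \<Rightarrow> nat" where
  "inner_steps A [] = 0"
| "inner_steps A [x] = 0"
| "inner_steps A (x # y # xs) = of_bool (x \<in> A \<and> y \<in> A) + inner_steps A (y # xs)"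

lemma inner_steps_append:
  assumes "xs \<noteq> []" "ys \<noteq> []"
  shows "inner_steps A (xs @ ys) = inner_steps A xs + inner_steps A ys + of_bool (last xs \<in> A \<and> hd ys \<in> A)"
  using assms
proof (induction A xs rule: inner_steps.induct)
  case (2 A x)
  then show ?case by (cases ys) auto
qed auto

lemma inner_steps_subset: "set xs \<subseteq> A \<Longrightarrow> inner_steps A xs = length xs - 1"
  by (induction A xs rule: inner_steps.induct) auto

lemma inner_steps_pos_split:
  assumes "inner_steps A p > 0"
  obtains xs ys where "p = xs @ ys" "xs \<noteq> []" "ys \<noteq> []" "last xs \<in> A" "hd ys \<in> A"
proof -
  have "\<exists>xs ys. p = xs @ ys \<and> xs \<noteq> [] \<and> ys \<noteq> [] \<and> last xs \<in> A \<and> hd ys \<in> A"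
    using assms
  proof (induction A p rule: inner_steps.induct)
    case (3 A x y zs)
    show ?case
    proof (cases "x \<in> A \<and> y \<in> A")
      case True
      then show ?thesis by (intro exI[of _ "[x]"] exI[of _ "y # zs"]) auto
    next
      case False
      with 3 obtain xs ys where "y # zs = xs @ ys" "xs \<noteq> []" "ys \<noteq> []" "last xs \<in> A" "hd ys \<in> A"
        by fastforce
      then show ?thesis by (intro exI[of _ "x # xs"] exI[of _ ys]) auto
    qed
  qed auto
  with that show thesis by blast
qed

definition vpath :: "('a \<Rightarrow> 'a \<Rightarrow> bool) \<Rightarrow> 'a \<Rightarrow> 'a \<Rightarrow> 'a list \<Rightarrow> bool" where
  "vpath E u v p \<longleftrightarrow> p \<noteq> [] \<and> hd p = u \<and> last p = v \<and> distinct p \<and> successively E p"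

lemma vpath_append:
  assumes "vpath E u a xs" "vpath E b v ys" "E a b" "set xs \<inter> set ys = {}"
  shows "vpath E u v (xs @ ys)"
  using assms by (auto simp: vpath_def successively_append_iff)

text \<open>In a clique every list of distinct vertices is a path, so it suffices to choose
  \<open>r - 2\<close> interior vertices.\<close>

lemma vpath_in_clique:
  assumes "finite A" "\<And>x y. x \<in> A \<Longrightarrow> y \<in> A \<Longrightarrow> x \<noteq> y \<Longrightarrow> E x y"
    and "a \<in> A" "b \<in> A" "a \<noteq> b" "2 \<le> r" "r \<le> card A"
  obtains q where "vpath E a b q" "set q \<subseteq> A" "length q = r"
proof -
  have "card (A - {a, b}) = card A - 2"
    using assms by (subst card_Diff_subset) auto
  then have "r - 2 \<le> card (A - {a, b})" using assms by simp
  then obtain T where T: "T \<subseteq> A - {a, b}" "card T = r - 2"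
    using obtain_subset_with_card_n by metis
  then have "finite T" using \<open>finite A\<close> by (meson finite_Diff finite_subset)
  then obtain ts where ts: "set ts = T" "distinct ts" using finite_distinct_list by blast
  then have "length ts = r - 2" using T distinct_card by metis
  have clique: "successively E q" if "set q \<subseteq> A" "distinct q" for q
    using that assms(2) by (induction E q rule: successively.induct) auto
  have "set (a # ts @ [b]) \<subseteq> A" "distinct (a # ts @ [b])"
    using T ts assms by auto
  then have "vpath E a b (a # ts @ [b])" using clique by (auto simp: vpath_def)
  moreover have "length (a # ts @ [b]) = r" using \<open>length ts = r - 2\<close> \<open>2 \<le> r\<close> by simp
  ultimately show thesis using that \<open>set (a # ts @ [b]) \<subseteq> A\<close> by blast
qed

text \<open>The index sets \<open>N i\<close> record which cliques are joined.
  \<open>matching\<close> provides the two distinct ends of a detour, and \<open>connected\<close>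
  provides the next clique to absorb, whichever proper subset has been absorbed so far.\<close>

locale clique_partition =
  fixes E :: "'a \<Rightarrow> 'a \<Rightarrow> bool" and R :: "'i set" and K :: "'i \<Rightarrow> 'a set"
    and N :: "'i \<Rightarrow> 'i set" and n :: nat
  assumes n: "n \<ge> 4" and finite_R: "finite R"
    and finite_N: "\<And>i. finite (N i)"
    and card_K: "\<And>i. i \<in> R \<Longrightarrow> card (K i) = n"
    and disjoint: "\<And>i j. i \<in> R \<Longrightarrow> j \<in> R \<Longrightarrow> i \<noteq> j \<Longrightarrow> K i \<inter> K j = {}"
    and sym: "\<And>x y. E x y \<Longrightarrow> E y x"
    and clique: "\<And>i x y. i \<in> R \<Longrightarrow> x \<in> K i \<Longrightarrow> y \<in> K i \<Longrightarrow> x \<noteq> y \<Longrightarrow> E x y"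
    and card_N: "\<And>i. card (N i) \<le> n - 2"
    and matching: "\<And>i j a b. i \<in> R \<Longrightarrow> j \<in> R \<Longrightarrow> j \<in> N i \<Longrightarrow> a \<in> K i \<Longrightarrow> b \<in> K i \<Longrightarrow> a \<noteq> b \<Longrightarrow>
        \<exists>a'\<in>K j. \<exists>b'\<in>K j. a' \<noteq> b' \<and> E a a' \<and> E b b'"
    and connected: "\<And>S. S \<subset> R \<Longrightarrow> S \<noteq> {} \<Longrightarrow> \<exists>i\<in>S. \<exists>j\<in>R - S. j \<in> N i"
begin

text \<open>
  Each edge of the path inside a clique \<open>K i\<close> can be replaced by a detour through one further
  clique \<open>K j\<close> with \<open>j \<in> N i\<close>. The last conjunct keeps enough of these edges in reserve: as
  \<open>card (N i) \<le> n - 2\<close>, one of them is left for every neighbour of \<open>i\<close> outside \<open>S\<close> when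
  \<open>t \<ge> n - 2\<close>.
\<close>
definition spread :: "'i set \<Rightarrow> nat \<Rightarrow> 'a \<Rightarrow> 'a \<Rightarrow> 'a list \<Rightarrow> bool" where
  "spread S t u v p \<longleftrightarrow> vpath E u v p \<and> set p \<subseteq> (\<Union>i\<in>S. K i) \<and>
     (\<forall>i\<in>S. t \<le> inner_steps (K i) p + card (N i \<inter> S))"

lemma finite_K: "i \<in> R \<Longrightarrow> finite (K i)"
  using card_K n by (metis card.infinite not_numeral_le_zero)

lemma path_in_K:
  assumes "i \<in> R" "a \<in> K i" "b \<in> K i" "a \<noteq> b" "2 \<le> r" "r \<le> n"
  obtains q where "vpath E a b q" "set q \<subseteq> K i" "length q = r"
proof (rule vpath_in_clique[OF finite_K[OF assms(1)] _ assms(2-5)])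
  show "E x y" if "x \<in> K i" "y \<in> K i" "x \<noteq> y" for x y
    using clique assms(1) that by blast
  show "r \<le> card (K i)" using card_K assms by simp
qed (rule that)

text \<open>The detour uses up one inner edge of \<open>K i\<close>, but \<open>j\<close> becomes
  one more absorbed neighbour of \<open>i\<close>, so the sum in \<open>spread\<close> does not
  drop. Other old cliques lose no inner edge, and the new one starts with \<open>r - 1\<close> of
  them.\<close>

lemma spread_insert:
  assumes p: "spread S t u v p" and S: "S \<subseteq> R" and i: "i \<in> S" and j: "j \<in> R" "j \<notin> S" "j \<in> N i"
    and t: "n - 2 \<le> t" and r: "2 \<le> r" "r \<le> n"
  shows "\<exists>p'. spread (insert j S) (min t (r - 1)) u v p' \<and> length p' = length p + r"
proof -
  have iR: "i \<in> R" using i S by blast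
  have card_insert: "card (N i \<inter> insert j S) = Suc (card (N i \<inter> S))"
    using j finite_N[of i] by simp
  have "card (N i \<inter> insert j S) \<le> n - 2"
    using card_mono[of "N i" "N i \<inter> insert j S"] finite_N card_N[of i] by force
  \<comment> \<open>As \<open>j\<close> is a neighbour outside \<open>S\<close>, at most
    \<open>n - 3\<close> neighbours of \<open>i\<close> lie in \<open>S\<close>, fewer than
    \<open>t\<close>.\<close>
  then have "inner_steps (K i) p > 0" using p i t card_insert by (fastforce simp: spread_def)
  then obtain xs ys where split: "p = xs @ ys" "xs \<noteq> []" "ys \<noteq> []" "last xs \<in> K i" "hd ys \<in> K i"
    by (rule inner_steps_pos_split)
  have "vpath E u v p" using p by (simp add: spread_def)
  then have xs: "vpath E u (last xs) xs" and ys: "vpath E (hd ys) v ys"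
    and xy: "set xs \<inter> set ys = {}"
    using split by (auto simp: vpath_def successively_append_iff)
  have "last xs \<noteq> hd ys" using xy split by (metis disjoint_iff hd_in_set last_in_set)
  then obtain a b where ab: "a \<in> K j" "b \<in> K j" "a \<noteq> b" "E (last xs) a" "E (hd ys) b"
    using matching[OF iR j(1,3) split(4,5)] by blast
  obtain q where q: "vpath E a b q" "set q \<subseteq> K j" "length q = r"
    using path_in_K[OF j(1) ab(1-3) r] .
  have new: "set p \<inter> K j = {}" using p j S disjoint by (force simp: spread_def)
  let ?p' = "xs @ q @ ys"
  have "vpath E u v ?p'"
    by (rule vpath_append[OF xs vpath_append[OF q(1) ys sym[OF ab(5)]] ab(4)])
      (use new xy q(2) split(1) in auto)
  moreover have "set ?p' \<subseteq> (\<Union>i\<in>insert j S. K i)" using p q(2) split(1) by (auto simp: spread_def)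
  moreover have "min t (r - 1) \<le> inner_steps (K k) ?p' + card (N k \<inter> insert j S)" if k: "k \<in> insert j S" for k
  proof -
    have q0: "q \<noteq> []" using q(3) r by auto
    have inner_new: "inner_steps (K k) ?p' \<ge> inner_steps (K k) xs + inner_steps (K k) q + inner_steps (K k) ys"
      using q0 split by (simp add: inner_steps_append)
    have inner_old: "inner_steps (K k) p = inner_steps (K k) xs + inner_steps (K k) ys + of_bool (last xs \<in> K k \<and> hd ys \<in> K k)"
      using split by (simp add: inner_steps_append)
    show ?thesis
    proof (cases "k = j")
      case True
      then show ?thesis using inner_new inner_steps_subset[OF q(2)] q(3) by simp
    next
      case False
      then have kS: "k \<in> S" using k by simp
      then have old: "t \<le> inner_steps (K k) p + card (N k \<inter> S)" using p by (simp add: spread_def)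
      show ?thesis
      proof (cases "k = i")
        case True
        moreover have "of_bool (last xs \<in> K k \<and> hd ys \<in> K k) \<le> (1 :: nat)" by simp
        ultimately show ?thesis using old inner_new inner_old card_insert True by simp
      next
        case False
        then have "last xs \<notin> K k" using disjoint[of k i] kS S iR split(4) by blast
        moreover have "card (N k \<inter> S) \<le> card (N k \<inter> insert j S)"
          by (rule card_mono) (use finite_N in auto)
        ultimately show ?thesis using old inner_new inner_old by simp
      qed
    qed
  qed
  ultimately have "spread (insert j S) (min t (r - 1)) u v ?p'" by (simp add: spread_def)
  then show ?thesis using split(1) q(3) by fastforce
qed

text \<open>
  A detour adds at least two vertices, so length \<open>n * card S + 1\<close> is reached from a path that
  omits one vertex.
\<close>
definition covers :: "'i set \<Rightarrow> 'a \<Rightarrow> 'a \<Rightarrow> bool" where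
  "covers S u v \<longleftrightarrow> (\<exists>p. spread S (n - 1) u v p \<and> length p = n * card S) \<and>
     (\<exists>p. spread S (n - 2) u v p \<and> length p = n * card S - 1)"

text \<open>Induction on the number of cliques outside \<open>S\<close>: whole cliques are absorbed
  until \<open>l\<close> is within one detour of \<open>n * card S\<close>.\<close>

lemma covers_extend:
  assumes "covers S u v" "S \<subseteq> R" "S \<noteq> {}" "n * card S < l" "l \<le> n * card R"
  shows "\<exists>p. vpath E u v p \<and> length p = l"
  using assms
proof (induction "card (R - S)" arbitrary: S rule: less_induct)
  case less
  obtain p0 p1 where p0: "spread S (n - 1) u v p0" "length p0 = n * card S"
    and p1: "spread S (n - 2) u v p1" "length p1 = n * card S - 1"
    using less.prems(1) by (auto simp: covers_def)
  have finS: "finite S" using less.prems finite_R finite_subset by blast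
  have "S \<noteq> R" using less.prems by auto
  then obtain i j where ij: "i \<in> S" "j \<in> R" "j \<notin> S" "j \<in> N i"
    using connected[of S] less.prems by blast
  note ins = spread_insert[OF _ \<open>S \<subseteq> R\<close> ij]
  have card_j: "card (insert j S) = Suc (card S)" using ij finS by simp
  have pos: "n * card S > 0" using finS less.prems n by (simp add: card_gt_0_iff)
  consider "l = n * card S + 1" | "n * card S + 2 \<le> l" "l \<le> n * card S + n"
    | "n * card (insert j S) < l"
    using less.prems card_j by fastforce
  then show ?case
  proof cases
    case 1
    \<comment> \<open>The smallest detour is added to the path omitting one vertex: -1 + 2 = +1. The
      low reserve is harmless, since no further clique is absorbed.\<close>
    obtain p' where "spread (insert j S) (min (n - 2) (2 - 1)) u v p'" "length p' = length p1 + 2"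
      using ins[OF p1(1), of 2] n by auto
    then show ?thesis using 1 p1(2) pos by (intro exI[of _ p']) (simp add: spread_def)
  next
    case 2
    define r where "r = l - n * card S"
    have r: "l = n * card S + r" "2 \<le> r" "r \<le> n" using 2 by (auto simp: r_def)
    obtain p' where "spread (insert j S) (min (n - 1) (r - 1)) u v p'" "length p' = length p0 + r"
      using ins[OF p0(1) diff_le_mono2 r(2,3)] by auto
    then show ?thesis using r p0(2) by (intro exI[of _ p']) (simp add: spread_def)
  next
    case 3
    have "covers (insert j S) u v"
    proof -
      \<comment> \<open>Both paths come from the full path \<open>p0\<close>: a detour through all
        of \<open>K j\<close>, and one omitting a single vertex of it. Extending \<open>p1\<close>
        instead would lower the reserve for the full path.\<close>
      have "\<exists>p. spread (insert j S) (n - 1) u v p \<and> length p = n * card (insert j S)"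
        using ins[OF p0(1), of n] n p0(2) card_j by (simp add: add.commute)
      moreover have "min (n - 1) (n - 1 - 1) = n - 2"
        "n * card S + (n - 1) = n * card (insert j S) - 1" using card_j n by auto
      then have "\<exists>p. spread (insert j S) (n - 2) u v p \<and> length p = n * card (insert j S) - 1"
        using ins[OF p0(1), of "n - 1"] n p0(2) by simp
      ultimately show ?thesis by (simp add: covers_def)
    qed
    moreover have "card (R - insert j S) < card (R - S)"
      using ij finite_R by (intro psubset_card_mono) auto
    ultimately show ?thesis using less.hyps[of "insert j S"] less.prems 3 ij by auto
  qed
qed

lemma path_same_clique:
  assumes i: "i \<in> R" "u \<in> K i" "v \<in> K i" "u \<noteq> v" and l: "2 \<le> l" "l \<le> n * card R"
  shows "\<exists>p. vpath E u v p \<and> length p = l"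
proof (cases "l \<le> n")
  case True
  then show ?thesis by (metis path_in_K[OF i l(1)])
next
  case False
  have "\<exists>p. spread {i} (r - 1) u v p \<and> length p = r" if "2 \<le> r" "r \<le> n" for r
  proof -
    obtain q where "vpath E u v q" "set q \<subseteq> K i" "length q = r"
      using path_in_K[OF i \<open>2 \<le> r\<close> \<open>r \<le> n\<close>] .
    then show ?thesis using inner_steps_subset[of q "K i"] by (auto simp: spread_def)
  qed
  \<comment> \<open>Paths on \<open>n\<close> and on \<open>n - 1\<close> vertices of the clique
    have \<open>n - 1\<close> and \<open>n - 2\<close> inner edges, the two reserves in
    \<open>covers\<close>.\<close>
  from this[of n] this[of "n - 1"] have "covers {i} u v" using n
    by (simp add: covers_def flip: numeral_2_eq_2)
  then show ?thesis using covers_extend[of "{i}"] i(1) l False by simp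
qed

text \<open>The initial path crosses once, along \<open>u'v'\<close>. Each of its two pieces has
  different ends, hence at least two vertices, so lengths start at 4.\<close>

lemma path_distinct_cliques:
  assumes i: "i \<in> R" "u \<in> K i" "u' \<in> K i" "u \<noteq> u'" and j: "j \<in> R" "v \<in> K j" "v' \<in> K j" "v \<noteq> v'"
    and "i \<noteq> j" "E u' v'" and l: "4 \<le> l" "l \<le> n * card R"
  shows "\<exists>p. vpath E u v p \<and> length p = l"
proof -
  have ex: "\<exists>p. spread {i, j} (min (r - 1) (s - 1)) u v p \<and> length p = r + s"
    if rs: "2 \<le> r" "r \<le> n" "2 \<le> s" "s \<le> n" for r s
  proof -
    obtain q where q: "vpath E u u' q" "set q \<subseteq> K i" "length q = r"
      using path_in_K[OF i rs(1,2)] .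
    obtain q' where q': "vpath E v' v q'" "set q' \<subseteq> K j" "length q' = s"
      using path_in_K[OF j(1,3,2) j(4)[symmetric] rs(3,4)] .
    have "vpath E u v (q @ q')"
      by (rule vpath_append[OF q(1) q'(1) \<open>E u' v'\<close>])
        (use disjoint[OF i(1) j(1) \<open>i \<noteq> j\<close>] q q' in blast)
    moreover have "q \<noteq> []" "q' \<noteq> []" using q q' rs by auto
    ultimately show ?thesis
      using q q' inner_steps_subset[OF q(2)] inner_steps_subset[OF q'(2)]
      by (intro exI[of _ "q @ q'"]) (auto simp: spread_def inner_steps_append)
  qed
  show ?thesis
  proof (cases "l \<le> 2 * n")
    case True
    \<comment> \<open>\<open>K i\<close> takes as many vertices as possible while leaving at least
      two for \<open>K j\<close>.\<close>
    define r where "r = min (l - 2) n"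
    have "2 \<le> r" "r \<le> n" "2 \<le> l - r" "l - r \<le> n" "r + (l - r) = l"
      using True l n by (auto simp: r_def)
    then show ?thesis using ex[of r "l - r"] by (metis spread_def)
  next
    case False
    have "\<exists>p. spread {i, j} (n - 1) u v p \<and> length p = n * card {i, j}"
      using ex[of n n] n \<open>i \<noteq> j\<close> by simp
    moreover have "min (n - 1) (n - 1 - 1) = n - 2" "n + (n - 1) = n * card {i, j} - 1"
      using n \<open>i \<noteq> j\<close> by auto
    then have "\<exists>p. spread {i, j} (n - 2) u v p \<and> length p = n * card {i, j} - 1"
      using ex[of n "n - 1"] n by simp
    ultimately have "covers {i, j} u v" by (simp add: covers_def)
    then show ?thesis using covers_extend[of "{i, j}"] i(1) j(1) l False \<open>i \<noteq> j\<close> by simp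
  qed
qed

end

subsection \<open>Cliques of rotations in the derangement graph\<close>

definition padj :: "nat \<Rightarrow> (nat \<Rightarrow> nat) \<Rightarrow> (nat \<Rightarrow> nat) \<Rightarrow> bool" where
  "padj n g h \<longleftrightarrow> g permutes {1..n} \<and> h permutes {1..n} \<and> (\<forall>i\<in>{1..n}. g i \<noteq> h i)"

lemma padj_sym: "padj n g h \<Longrightarrow> padj n h g"
  by (auto simp: padj_def)

lemma padj_compose_right:
  assumes "padj n g h" "p permutes {1..n}"
  shows "padj n (g \<circ> p) (h \<circ> p)"
  unfolding padj_def
proof (intro conjI ballI)
  fix i assume "i \<in> {1..n}"
  then have "p i \<in> {1..n}" using permutes_in_image[OF assms(2)] by blast
  then show "(g \<circ> p) i \<noteq> (h \<circ> p) i" using assms(1) by (simp add: padj_def)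
qed (use assms in \<open>auto simp: padj_def intro: permutes_compose\<close>)

lemma padj_compose_left:
  assumes "padj n g h" "p permutes {1..n}"
  shows "padj n (p \<circ> g) (p \<circ> h)"
  using assms permutes_inj[OF assms(2)]
  by (auto simp: padj_def inj_eq intro: permutes_compose)

lemma parcs_derangement_graph_iff: "(g, h) \<in> parcs (derangement_graph n) \<longleftrightarrow> padj n g h"
proof (cases "g permutes {1..n} \<and> h permutes {1..n}")
  case True
  then show ?thesis using derangement_graph_adj_iff[of g n h]
    by (simp add: padj_def sym_group_carrier)
next
  case False
  then show ?thesis
    by (auto simp: padj_def derangement_graph_def cayley_graph_def sym_group_carrier)
qed

text \<open>
  In a permutation agreeing with \<open>u\<close> or \<open>v\<close> in the fewest points, a point \<open>x\<close> of agreement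
  could be repaired by swapping the values at \<open>x\<close> and \<open>y\<close>, unless \<open>y\<close> is one of three points.
\<close>
lemma padj_common_neighbour:
  assumes n: "n \<ge> 4" and "padj n u v"
  shows "\<exists>w. padj n w u \<and> padj n w v"
proof -
  have u: "u permutes {1..n}" and v: "v permutes {1..n}" using assms by (auto simp: padj_def)
  define bad where "bad w = {x \<in> {1..n}. w x = u x \<or> w x = v x}" for w
  obtain w where w: "w permutes {1..n}"
    and least: "\<And>w'. w' permutes {1..n} \<Longrightarrow> card (bad w) \<le> card (bad w')"
    using ex_has_least_nat[of "\<lambda>w. w permutes {1..n}" id "\<lambda>w. card (bad w)"] permutes_id
    by blast
  have "bad w = {}"
  proof (rule ccontr)
    assume "bad w \<noteq> {}"
    then obtain x where x: "x \<in> {1..n}" "w x = u x \<or> w x = v x" by (auto simp: bad_def)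
    \<comment> \<open>For the permutation agreeing with \<open>w\<close> at \<open>x\<close>,
      injectivity already prevents a new agreement after the swap. Only the other one,
      \<open>z\<close>, excludes values of \<open>y\<close>.\<close>
    define z where "z = (if w x = u x then v else u)"
    define F where "F = {x, inv' w (z x), inv' z (w x)}"
    have z: "z permutes {1..n}" using u v by (simp add: z_def)
    have "card F \<le> 3" by (simp add: F_def card_insert_if)
    then have "\<not> {1..n} \<subseteq> F"
      using card_mono[of F "{1..n}"] n by (auto simp: F_def)
    then obtain y where "y \<in> {1..n}" "y \<notin> F" by blast
    then have y: "y \<in> {1..n}" "y \<noteq> x" "y \<noteq> inv' w (z x)" "y \<noteq> inv' z (w x)"
      unfolding F_def by blast+
    have "w y \<noteq> z x" "z y \<noteq> w x"
      using y by (metis permutes_inverses(2)[OF w]) (metis y(4) permutes_inverses(2)[OF z])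
    moreover have "w y \<noteq> w x" "u y \<noteq> u x" "v y \<noteq> v x"
      using y(2) permutes_inj[OF w] permutes_inj[OF u] permutes_inj[OF v] by (auto simp: inj_eq)
    ultimately have good: "w y \<noteq> u x" "w y \<noteq> v x" "u y \<noteq> w x" "v y \<noteq> w x"
      using x(2) by (auto simp: z_def split: if_splits)
    let ?w = "w \<circ> transpose x y"
    have "?w permutes {1..n}"
      using permutes_compose[OF permutes_swap_id w] x y by blast
    moreover have "bad ?w \<subset> bad w"
    proof
      show "bad ?w \<subseteq> bad w"
        using good y(2) by (auto simp: bad_def transpose_def split: if_splits)
      have "x \<in> bad w" "x \<notin> bad ?w" using good x by (auto simp: bad_def)
      then show "bad ?w \<noteq> bad w" by blast
    qed
    then have "card (bad ?w) < card (bad w)"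
      by (intro psubset_card_mono) (auto simp: bad_def)
    ultimately show False using least[of ?w] by simp
  qed
  then show ?thesis using u v w by (auto simp: bad_def padj_def)
qed

section \<open>Rotations of the positions\<close>

definition rot :: "nat \<Rightarrow> nat \<Rightarrow> nat \<Rightarrow> nat" where
  "rot n i x = (if x \<in> {1..n} then (x - 1 + i) mod n + 1 else x)"

lemma rot_in: "x \<in> {1..n} \<Longrightarrow> rot n i x \<in> {1..n}"
  by (auto simp: rot_def Suc_le_eq)

text \<open>Residues cancel, so two rotations that agree at a single point agree everywhere. This
  makes the rotation classes cliques.\<close>

lemma rot_eq_iff:
  assumes "x \<in> {1..n}"
  shows "rot n i x = rot n j x \<longleftrightarrow> i mod n = j mod n"
proof -
  have "rot n i x = rot n j x \<longleftrightarrow> [x - 1 + i = x - 1 + j] (mod n)"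
    using assms by (simp add: rot_def cong_def)
  then show ?thesis by (simp add: cong_add_lcancel_nat) (simp add: cong_def)
qed

lemma rot_cong: "i mod n = j mod n \<Longrightarrow> rot n i = rot n j"
  using rot_eq_iff by (fastforce simp: rot_def)

lemma rot_compose: "rot n i \<circ> rot n j = rot n (i + j)"
proof
  fix x
  show "(rot n i \<circ> rot n j) x = rot n (i + j) x"
  proof (cases "x \<in> {1..n}")
    case True
    then show ?thesis using rot_in[OF True, of j]
      by (simp add: rot_def mod_simps ac_simps)
  next
    case False
    then show ?thesis by (auto simp: rot_def)
  qed
qed

lemma rot_0: "rot n 0 = id"
  by (auto simp: rot_def fun_eq_iff)

lemma rot_self: "rot n n = id"
  using rot_cong[of n n 0] rot_0 by simp

lemma rot_permutes: "rot n i permutes {1..n}"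
proof (rule bij_imp_permutes)
  have "inj_on (rot n i) {1..n}"
  proof (rule inj_on_inverseI)
    fix x assume "x \<in> {1..n}"
    have "rot n (n - i mod n) (rot n i x) = rot n (n - i mod n + i) x"
      using rot_compose[of n "n - i mod n" i] by (metis comp_apply)
    also have "(n - i mod n + i) mod n = 0"
    proof -
      have "(n - i mod n + i) mod n = (n - i mod n + i mod n) mod n" by (simp add: mod_simps)
      then show ?thesis using \<open>x \<in> {1..n}\<close> by (simp add: mod_le_divisor)
    qed
    then have "rot n (n - i mod n + i) x = x" using rot_cong[of "n - i mod n + i" n 0] rot_0 by simp
    finally show "rot n (n - i mod n) (rot n i x) = x" .
  qed
  moreover have "rot n i ` {1..n} \<subseteq> {1..n}" using rot_in by blast
  ultimately show "bij_betw (rot n i) {1..n} {1..n}"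
    by (simp add: bij_betw_def endo_inj_surj)
qed (auto simp: rot_def)

lemma padj_rot: "i mod n \<noteq> j mod n \<Longrightarrow> padj n (rot n i) (rot n j)"
  using rot_permutes rot_eq_iff by (auto simp: padj_def)

text \<open>
  This gives the perfect matching between the cliques of \<open>g\<close> and \<open>g \<circ> transpose k (Suc k)\<close>. For
  \<open>n = 4\<close> the rotation by \<open>2\<close> is the only one with this property.
\<close>
lemma padj_rot_2_transpose:
  assumes "n \<ge> 4" "1 \<le> k" "k < n"
  shows "padj n (rot n 2) (transpose k (Suc k))"
proof -
  have "rot n 2 x \<noteq> transpose k (Suc k) x" if x: "x \<in> {1..n}" for x
  proof -
    \<comment> \<open>The rotation displaces points by 2 or 2 - n, hence by at least 2 in absolute
      value as \<open>n \<ge> 4\<close>; the transposition displaces them by at most 1.\<close>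
    have "rot n 2 x = (if x + 1 < n then x + 2 else x + 2 - n)"
    proof (cases "x + 1 < n")
      case False
      then have "(x - 1 + 2) mod n = x + 1 - n"
        using x assms by (simp add: mod_if)
      then show ?thesis using False x by (simp add: rot_def)
    qed (use x in \<open>simp add: rot_def\<close>)
    then show ?thesis using x assms by (auto simp: transpose_def)
  qed
  moreover have "transpose k (Suc k) permutes {1..n}"
    using assms by (intro permutes_swap_id) auto
  ultimately show ?thesis using rot_permutes by (auto simp: padj_def)
qed

section \<open>Left cosets of the cyclic group of rotations\<close>

definition rot_class :: "nat \<Rightarrow> (nat \<Rightarrow> nat) \<Rightarrow> (nat \<Rightarrow> nat) set" where
  "rot_class n g = range (\<lambda>i. g \<circ> rot n i)"

text \<open>Rotating the position of the value \<open>n\<close> to the last place gives a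
  representative fixing \<open>n\<close>.\<close>

lemma rot_class_cover:
  assumes "n \<ge> 1" "w permutes {1..n}"
  obtains g where "g permutes {1..n - 1}" "w \<in> rot_class n g"
proof -
  define i where "i = inv' w n"
  have i: "i \<in> {1..n}"
    using permutes_in_image[OF permutes_inv[OF assms(2)], of n] assms(1) by (simp add: i_def)
  have "n - 1 + i = n + (i - 1)" using i assms(1) by auto
  then have "(n - 1 + i) mod n = (i - 1) mod n" by (metis mod_add_self1)
  moreover have "i - 1 < n" using i by auto
  ultimately have "(n - 1 + i) mod n = i - 1" by (metis mod_less)
  then have "rot n i n = i" using i assms(1) by (simp add: rot_def)
  then have "(w \<circ> rot n i) n = n" by (simp add: i_def permutes_inverses[OF assms(2)])
  moreover have "x = n" if "x \<in> {1..n} - {1..n - 1}" for x using that by auto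
  ultimately have "(w \<circ> rot n i) x = x" if "x \<in> {1..n} - {1..n - 1}" for x
    using that by metis
  then have "w \<circ> rot n i permutes {1..n - 1}"
    by (rule permutes_superset[OF permutes_compose[OF rot_permutes assms(2)]])
  moreover have "w = (w \<circ> rot n i) \<circ> rot n (n - i)"
    using i rot_compose[of n i "n - i"] rot_self by (simp add: comp_assoc)
  then have "w \<in> rot_class n (w \<circ> rot n i)" unfolding rot_class_def by blast
  ultimately show thesis by (rule that)
qed

text \<open>As \<open>g\<close> and \<open>h\<close> fix \<open>n\<close>, the position of the value
  \<open>n\<close> in a common element determines the rotation, which then cancels.\<close>

lemma rot_class_disjoint:
  assumes n: "n \<ge> 1" and g: "g permutes {1..n - 1}" and h: "h permutes {1..n - 1}"
    and "rot_class n g \<inter> rot_class n h \<noteq> {}"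
  shows "g = h"
proof -
  obtain i j where eq: "g \<circ> rot n i = h \<circ> rot n j"
    using assms(4) by (auto simp: rot_class_def)
  obtain x where x: "x \<in> {1..n}" "rot n i x = n"
    using permutes_image[OF rot_permutes[of n i]] n by (metis atLeastAtMost_iff imageE order_refl)
  have fix_n: "g n = n" "h n = n"
    using permutes_not_in[OF g] permutes_not_in[OF h] n by auto
  then have "h (rot n j x) = h n" using x fun_cong[OF eq, of x] by simp
  then have "rot n j x = rot n i x" using permutes_inj[OF h] x by (simp add: inj_eq)
  then have "rot n j = rot n i" using rot_eq_iff[OF x(1)] rot_cong by blast
  then have "g \<circ> rot n i = h \<circ> rot n i" using eq by simp
  then have "g \<circ> (rot n i \<circ> inv' (rot n i)) = h \<circ> (rot n i \<circ> inv' (rot n i))"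
    by (metis comp_assoc)
  then show ?thesis by (simp add: permutes_inv_o[OF rot_permutes])
qed

lemma compose_left_cancel:
  assumes "g permutes A" "g \<circ> p = g \<circ> q"
  shows "p = q"
  using assms permutes_inj[of g A] by (metis fun.inj_map_strong inj_eq ext comp_apply)

lemma card_rot_class:
  assumes "n \<ge> 1" and g: "g permutes A"
  shows "card (rot_class n g) = n"
proof -
  have "rot_class n g = (\<lambda>i. g \<circ> rot n i) ` {..<n}"
  proof -
    have "g \<circ> rot n i \<in> (\<lambda>i. g \<circ> rot n i) ` {..<n}" for i
      using rot_cong[of "i mod n" n i] assms(1) by (intro image_eqI[of _ _ "i mod n"]) auto
    then show ?thesis by (auto simp: rot_class_def)
  qed
  moreover have "inj_on (\<lambda>i. g \<circ> rot n i) {..<n}"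
  proof (rule inj_onI)
    fix i j assume ij: "i \<in> {..<n}" "j \<in> {..<n}" "g \<circ> rot n i = g \<circ> rot n j"
    then have "rot n i n = rot n j n" using compose_left_cancel[OF g] by metis
    then show "i = j" using rot_eq_iff[of n n i j] ij by auto
  qed
  ultimately show ?thesis by (simp add: card_image)
qed

text \<open>Adjacent transpositions generate the symmetric group; the closure form is what
  connectivity of the cliques requires.\<close>

lemma closed_adjacent_transpose:
  assumes closed: "\<And>g k. g \<in> S \<Longrightarrow> 1 \<le> k \<Longrightarrow> k < m \<Longrightarrow> g \<circ> transpose k (Suc k) \<in> S"
    and "g \<in> S" "p permutes {1..m}"
  shows "g \<circ> p \<in> S"
proof -
  have step: "h \<circ> transpose a (a + Suc d) \<in> S" if "h \<in> S" "1 \<le> a" "a + Suc d \<le> m" for h a d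
    using that
  proof (induction d arbitrary: h)
    case 0
    then have "h \<circ> transpose a (Suc a) \<in> S" by (intro closed) auto
    then show ?case by (simp only: add_Suc_right add_0_right)
  next
    case (Suc d)
    let ?t = "transpose (a + Suc d) (Suc (a + Suc d))"
    have "h \<circ> ?t \<in> S" by (rule closed) (use Suc.prems in auto)
    then have "h \<circ> ?t \<circ> transpose a (a + Suc d) \<in> S" by (rule Suc.IH) (use Suc.prems in auto)
    then have "h \<circ> ?t \<circ> transpose a (a + Suc d) \<circ> ?t \<in> S"
      by (rule closed) (use Suc.prems in auto)
    \<comment> \<open>Conjugation by an adjacent transposition widens the gap by one.\<close>
    moreover have "?t \<circ> transpose a (a + Suc d) \<circ> ?t = transpose a (a + Suc (Suc d))"
      by (auto simp: transpose_def fun_eq_iff)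
    ultimately show ?case by (simp only: comp_assoc)
  qed
  have transpose_closed: "h \<circ> transpose a b \<in> S" if "h \<in> S" "a \<in> {1..m}" "b \<in> {1..m}" "a \<noteq> b" for h a b
  proof (cases "a < b")
    case True
    then show ?thesis using step[of h a "b - Suc a"] that by simp
  next
    case False
    then show ?thesis using step[of h b "a - Suc b"] that by (simp add: transpose_commute)
  qed
  have "finite {1..m}" by simp
  from this assms(3) show ?thesis
  proof (induction rule: permutes_rev_induct)
    case id
    then show ?case using \<open>g \<in> S\<close> by simp
  next
    case (swap a b p)
    then have "g \<circ> p \<circ> transpose a b \<in> S" by (intro transpose_closed)
    then show ?case by (simp only: comp_assoc)
  qed
qed

text \<open>The bound \<open>k \<le> n - 2\<close> keeps the transpositions within
  \<open>{1..n - 1}\<close>, so neighbouring representatives still fix \<open>n\<close>, and it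
  gives the bound \<open>card_N\<close>.\<close>

lemma clique_partition_rot_class:
  assumes n: "n \<ge> 4"
  shows "clique_partition (padj n) {g. g permutes {1..n - 1}} (rot_class n)
    (\<lambda>g. (\<lambda>k. g \<circ> transpose k (Suc k)) ` {1..n - 2}) n"
proof
  have perm: "g permutes {1..n}" if "g permutes {1..n - 1}" for g
    using permutes_subset[OF that] by auto
  show "n \<ge> 4" by (rule n)
  show "finite {g. g permutes {1..n - 1}}" by (simp add: finite_permutations)
  show "finite ((\<lambda>k. g \<circ> transpose k (Suc k)) ` {1..n - 2})" for g :: "nat \<Rightarrow> nat" by simp
  show "card ((\<lambda>k. g \<circ> transpose k (Suc k)) ` {1..n - 2}) \<le> n - 2" for g :: "nat \<Rightarrow> nat"
    using card_image_le[of "{1..n - 2}"] by (metis card_atLeastAtMost diff_Suc_1 finite_atLeastAtMost)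
  show "card (rot_class n g) = n" if "g \<in> {g. g permutes {1..n - 1}}" for g
    using card_rot_class[of n g "{1..n - 1}"] n that by simp
  show "rot_class n g \<inter> rot_class n h = {}"
    if "g \<in> {g. g permutes {1..n - 1}}" "h \<in> {g. g permutes {1..n - 1}}" "g \<noteq> h" for g h
    using rot_class_disjoint[of n g h] n that by auto
  show "padj n h g" if "padj n g h" for g h using padj_sym that .
  show "padj n x y"
    if "g \<in> {g. g permutes {1..n - 1}}" "x \<in> rot_class n g" "y \<in> rot_class n g" "x \<noteq> y" for g x y
  proof -
    obtain i j where ij: "x = g \<circ> rot n i" "y = g \<circ> rot n j"
      using \<open>x \<in> rot_class n g\<close> \<open>y \<in> rot_class n g\<close> by (auto simp: rot_class_def)
    then have "i mod n \<noteq> j mod n" using \<open>x \<noteq> y\<close> rot_cong by metis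
    then show ?thesis using padj_compose_left[OF padj_rot perm] that ij by simp
  qed
  show "\<exists>a'\<in>rot_class n h. \<exists>b'\<in>rot_class n h. a' \<noteq> b' \<and> padj n a a' \<and> padj n b b'"
    if g: "g \<in> {g. g permutes {1..n - 1}}" and "h \<in> {g. g permutes {1..n - 1}}"
      and h: "h \<in> (\<lambda>k. g \<circ> transpose k (Suc k)) ` {1..n - 2}"
      and ab: "a \<in> rot_class n g" "b \<in> rot_class n g" "a \<noteq> b" for g h a b
  proof -
    obtain k where k: "1 \<le> k" "k \<le> n - 2" "h = g \<circ> transpose k (Suc k)" using h by auto
    \<comment> \<open>\<open>i + n - 2\<close> represents i - 2 modulo \<open>n\<close> while
      avoiding truncated subtraction.\<close>
    have unrotate: "rot n 2 \<circ> rot n (i + n - 2) = rot n i" for i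
    proof -
      have "2 + (i + n - 2) = i + n" using n by simp
      then show ?thesis using rot_cong[of "i + n" n i] by (simp only: rot_compose mod_add_self2)
    qed
    \<comment> \<open>The adjacency of \<open>rot n 2\<close> and the transposition is composed with
      \<open>g\<close> on the left and with the rotation by i - 2 on the right.\<close>
    have adj: "padj n (g \<circ> rot n i) (h \<circ> rot n (i + n - 2))" for i
    proof -
      have "padj n (g \<circ> rot n 2 \<circ> rot n (i + n - 2)) (h \<circ> rot n (i + n - 2))"
        unfolding k(3) using g k n
        by (intro padj_compose_right padj_compose_left padj_rot_2_transpose rot_permutes perm) auto
      then show ?thesis by (simp only: comp_assoc unrotate)
    qed
    obtain i j where ij: "a = g \<circ> rot n i" "b = g \<circ> rot n j"
      using ab by (auto simp: rot_class_def)
    have "h \<circ> rot n (i + n - 2) \<noteq> h \<circ> rot n (j + n - 2)"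
    proof
      assume "h \<circ> rot n (i + n - 2) = h \<circ> rot n (j + n - 2)"
      then have "rot n (i + n - 2) = rot n (j + n - 2)"
        using compose_left_cancel[of h "{1..n - 1}"] that(2) by blast
      then have "rot n i = rot n j" using unrotate by metis
      then show False using ab ij by simp
    qed
    then show ?thesis using adj ij by (auto simp: rot_class_def)
  qed
  show "\<exists>g\<in>S. \<exists>h\<in>{g. g permutes {1..n - 1}} - S. h \<in> (\<lambda>k. g \<circ> transpose k (Suc k)) ` {1..n - 2}"
    if S: "S \<subset> {g. g permutes {1..n - 1}}" "S \<noteq> {}" for S
  proof (rule ccontr)
    \<comment> \<open>If no join leaves \<open>S\<close>, then \<open>S\<close> is closed under
      adjacent transpositions and hence contains every representative.\<close>
    assume none: "\<not> ?thesis"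
    have closed: "g \<circ> transpose k (Suc k) \<in> S" if gS: "g \<in> S" "1 \<le> k" "k < n - 1" for g k
    proof -
      have "g permutes {1..n - 1}" using gS(1) S by blast
      moreover have "transpose k (Suc k) permutes {1..n - 1}"
        using gS by (intro permutes_swap_id) auto
      ultimately have "g \<circ> transpose k (Suc k) permutes {1..n - 1}"
        using permutes_compose by blast
      moreover have "k \<in> {1..n - 2}" using gS by auto
      ultimately show ?thesis using none gS(1) by blast
    qed
    obtain g where g: "g \<in> S" using S by blast
    then have gp: "g permutes {1..n - 1}" using S by blast
    have "h \<in> S" if h: "h permutes {1..n - 1}" for h
    proof -
      have "g \<circ> (inv' g \<circ> h) \<in> S"
        using closed_adjacent_transpose[OF closed g, where p = "inv' g \<circ> h"]
          permutes_compose[OF h permutes_inv[OF gp]] by blast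
      then show ?thesis by (simp add: comp_assoc[symmetric] permutes_inv_o[OF gp])
    qed
    then show False using S by blast
  qed
qed

lemma padj_path:
  assumes n: "n \<ge> 4" and uv: "padj n u v" and l: "3 \<le> l" "l \<le> fact n"
  shows "\<exists>p. vpath (padj n) u v p \<and> length p = l"
proof (cases "l = 3")
  case True
  \<comment> \<open>Three vertices are too few for the crossing construction when \<open>u\<close>
    and \<open>v\<close> lie in different cliques; a common neighbour serves instead.\<close>
  obtain w where w: "padj n w u" "padj n w v" using padj_common_neighbour[OF n uv] by blast
  have irrefl: "g \<noteq> h" if "padj n g h" for g h
    using that n by (auto simp: padj_def)
  have "vpath (padj n) u v [u, w, v]"
    using w uv irrefl[OF w(1)] irrefl[OF w(2)] irrefl[OF uv] padj_sym
    by (auto simp: vpath_def)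
  then show ?thesis using True by (intro exI[of _ "[u, w, v]"]) simp
next
  case False
  interpret clique_partition "padj n" "{g. g permutes {1..n - 1}}" "rot_class n"
    "\<lambda>g. (\<lambda>k. g \<circ> transpose k (Suc k)) ` {1..n - 2}" n
    by (rule clique_partition_rot_class[OF n])
  have "card {g. g permutes {1..n - 1}} = fact (n - 1)"
    using card_permutations[of "{1..n - 1}" "n - 1"] by simp
  then have N: "n * card {g. g permutes {1..n - 1}} = fact n"
    using n by (simp add: fact_reduce)
  have u: "u permutes {1..n}" and v: "v permutes {1..n}" and neq: "\<forall>i\<in>{1..n}. u i \<noteq> v i"
    using uv by (auto simp: padj_def)
  have "u \<noteq> v" using neq n by (metis atLeastAtMost_iff le_trans one_le_numeral order_refl)
  obtain g where g: "g permutes {1..n - 1}" "u \<in> rot_class n g"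
    using rot_class_cover[OF _ u] n by auto
  obtain h where h: "h permutes {1..n - 1}" "v \<in> rot_class n h"
    using rot_class_cover[OF _ v] n by auto
  show ?thesis
  proof (cases "g = h")
    case True
    then show ?thesis using path_same_clique[of g u v l] g h \<open>u \<noteq> v\<close> l N by simp
  next
    case False
    \<comment> \<open>The crossing edge is \<open>uv\<close> rotated by 1. The rotation preserves
      both classes but moves \<open>u\<close> and \<open>v\<close>.\<close>
    have shift: "w \<circ> rot n 1 \<in> rot_class n f" if "w \<in> rot_class n f" for w f
      using that by (auto simp: rot_class_def comp_assoc rot_compose)
    have moved: "w \<circ> rot n 1 \<noteq> w" if "w permutes {1..n}" for w
    proof
      assume "w \<circ> rot n 1 = w"
      then have "rot n 1 = rot n 0" using compose_left_cancel[OF that, of "rot n 1" id] rot_0 by simp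
      then show False using rot_eq_iff[of n n 1 0] n by simp
    qed
    have "padj n (u \<circ> rot n 1) (v \<circ> rot n 1)" by (rule padj_compose_right[OF uv rot_permutes])
    then show ?thesis
      by (intro path_distinct_cliques[OF _ g(2) shift[OF g(2)] moved[OF u, symmetric] _ h(2)
            shift[OF h(2)] moved[OF v, symmetric] False])
        (use g h l \<open>l \<noteq> 3\<close> N in simp_all)
  qed
qed

subsection \<open>Cycles\<close>

text \<open>\<open>zip\<close> stops at the shorter list, so \<open>zip (x # p) p\<close> pairs each
  vertex with its successor: it is the arc list of the walk through \<open>x # p\<close>.\<close>

lemma pcas_zip: "pcas x (zip (x # p) p) (last (x # p))"
  by (induction p arbitrary: x) auto

lemma pawalk_verts_zip: "pawalk_verts x (zip (x # p) p) = x # p"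
  by (induction p arbitrary: x) auto

lemma set_zip_subset:
  assumes "successively E (x # p)"
  shows "set (zip (x # p) p) \<subseteq> {(a, b). E a b}"
  using assms by (induction p arbitrary: x) auto

text \<open>Prefixing \<open>u\<close> to a path from \<open>v\<close> to \<open>u\<close> closes it
  by the arc \<open>(u, v)\<close>. The cycle has as many arcs as the path has vertices.\<close>

lemma vpath_cycle:
  fixes G :: "'a pair_pre_digraph"
  assumes p: "vpath (\<lambda>a b. (a, b) \<in> parcs G) v u p" and uv: "(u, v) \<in> parcs G" "u \<in> pverts G"
  shows "\<exists>c. pre_digraph.cycle (with_proj G) c \<and> length c = length p \<and> (u, v) \<in> set c"
proof (intro exI conjI)
  let ?c = "zip (u # p) p"
  have p': "p \<noteq> []" "hd p = v" "last p = u" "distinct p" "successively (\<lambda>a b. (a, b) \<in> parcs G) p"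
    using p by (auto simp: vpath_def)
  have "set ?c \<subseteq> parcs G"
    using set_zip_subset[of "\<lambda>a b. (a, b) \<in> parcs G" u p] p' uv by (auto simp: successively_Cons)
  moreover have "pcas u ?c u" using pcas_zip[of u p] p' by simp
  moreover have "?c \<noteq> []" using p' by (cases p) auto
  ultimately show "pre_digraph.cycle (with_proj G) ?c"
    unfolding pre_digraph.cycle_def pre_digraph.awalk_def cas_with_proj_eq awalk_verts_with_proj_eq
    using uv(2) p'(4) pawalk_verts_zip[of u p] by (intro exI[of _ u]) simp
  show "length ?c = length p" by simp
  show "(u, v) \<in> set ?c" using p' by (cases p) auto
qed

theorem theorem1p1:
  fixes n :: nat
  assumes "n \<ge> 4"
  shows "edge_pancyclic (with_proj (derangement_graph n))"
proof -
  let ?G = "derangement_graph n"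
  interpret pair_graph ?G using pair_graph_derangement_graph assms by simp
  have "(3 :: nat) \<le> fact n" using fact_ge_self[of n] assms by simp
  moreover have "\<exists>c. pre_digraph.cycle (with_proj ?G) c \<and> length c = l \<and> (u, v) \<in> set c"
    if uv: "(u, v) \<in> parcs ?G" and l: "3 \<le> l" "l \<le> fact n" for u v l
  proof -
    have "padj n v u" using uv padj_sym by (simp add: parcs_derangement_graph_iff)
    then obtain p where "vpath (padj n) v u p" "length p = l"
      using padj_path[OF assms _ l] by blast
    moreover have "u \<in> pverts ?G" using uv by (rule in_arcsD1)
    ultimately show ?thesis
      using vpath_cycle[of ?G v u p] uv by (simp add: parcs_derangement_graph_iff)
  qed
  ultimately show ?thesis
    unfolding edge_pancyclic_def using graph_axioms by (auto simp: card_derangement_graph)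
qed

end
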